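(* Let $n,N,D\in\mathbb{N}$, let $\mathcal{X}\subseteq\mathbb{R}^n$ be the set of feasible solutions, let $\bm{c}_1,\ldots,\bm{c}_N\in\mathbb{R}^n$ be cost vectors, and let $\mathcal{T}$ be the set of univariate decision trees of depth $D$ mapping cost vectors to solutions in $\mathcal{X}$ (as defined in the context). Let $$M=\max_{i\in[n]}\Big\{\max_{j\in[N]}c_{j,i}-\min_{j\in[N]}c_{j,i}\Big\}.$$ Suppose that either $\mathcal{U}=\mathcal{U}_{glob}(\Gamma^{\text{glob}})$ with $\Gamma^{\text{glob}}>D\cdot N\cdot M$, or $\mathcal{U}=\mathcal{U}_{loc}(\Gamma^{\text{loc}})$ with $\Gamma^{\text{loc}}>D\cdot M$. Let $\bm{x}^*$ be an optimal solution of $\min_{\bm{x}\in\mathcal{X}}\sum_{j\in[N]}\bm{c}_j^\top\bm{x}$. Then the surrogate that maps every cost vector to $\bm{x}^*$ (i.e. the tree with $\bm{x}^*$ in every leaf) is an optimal solution of $$\min_{T\in\mathcal{T}}\ \max_{(\bm{\xi}_1,\ldots,\bm{\xi}_N)\in\mathcal{U}}\ \sum_{j\in[N]}\bm{c}_j^\top T(\bm{c}_j+\bm{\xi}_j).$$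
   Context: Notation: $[N]=\{1,\ldots,N\}$; $c_{j,i}$ is the $i$-th entry of $\bm{c}_j$. A univariate decision tree of depth $D$ is a complete binary tree of depth $D$ (with $2^D$ leaves). Each inner node carries an item $i\in[n]$ and a threshold $\theta\in[\min_{j\in[N]}c_{j,i},\max_{j\in[N]}c_{j,i}]$; each leaf $k$ carries a solution $\bm{x}_k\in\mathcal{X}$. Such a tree defines a map $T:\mathbb{R}^n\to\mathcal{X}$: given $\hat{\bm{c}}\in\mathbb{R}^n$, start at the root; at an inner node with item $i$ and threshold $\theta$ go to the left child if $\hat c_i\le\theta$ and to the right child if $\hat c_i>\theta$; $T(\hat{\bm{c}})$ is the solution carried by the leaf that is reached. (Trees of smaller depth are represented by placing the same solution in several leaves.) The global and local budgeted uncertainty sets are $$\mathcal{U}_{glob}(\Gamma)=\Big\{(\bm{\xi}_1,\ldots,\bm{\xi}_N)^\top\in\mathbb{R}^{N\times n}:\ \sum_{j\in[N]}\sum_{i\in[n]}|\xi_{j,i}|\le\Gamma\Big\},$$ $$\mathcal{U}_{loc}(\Gamma)=\Big\{(\bm{\xi}_1,\ldots,\bm{\xi}_N)^\top\in\mathbb{R}^{N\times n}:\ \sum_{i\in[n]}|\xi_{j,i}|\le\Gamma\ \ \forall j\in[N]\Big\}.$$ It is assumed that $\mathcal{X}$ is nonempty and that linear minimization problems over $\mathcal{X}$ attain their minimum. *)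

theory Defs
  imports "HOL-Analysis.Analysis"
begin

text \<open>
  The index types \<open>'n\<close> (items) and \<open>'m\<close> (scenarios) stand for $[n]$ and $[N]$, so that
  $N$ is \<open>CARD('m)\<close>. The cost vectors $c_1,\ldots,c_N$ and the perturbations
  $\xi_1,\ldots,\xi_N$ are the rows of matrices of type \<open>real ^ 'n ^ 'm\<close>.
\<close>

datatype ('i, solutions: 's) dtree =
    Leaf 's
  | Node 'i real "('i, 's) dtree" "('i, 's) dtree"

primrec tree_map :: "('n, 's) dtree \<Rightarrow> real ^ 'n \<Rightarrow> 's" where
  "tree_map (Leaf x) v = x"
| "tree_map (Node i \<theta> l r) v = (if v $ i \<le> \<theta> then tree_map l v else tree_map r v)"

definition cost_min :: "real ^ 'n ^ 'm \<Rightarrow> 'n \<Rightarrow> real" where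
  "cost_min c i = Min (range (\<lambda>j. c $ j $ i))"

definition cost_max :: "real ^ 'n ^ 'm \<Rightarrow> 'n \<Rightarrow> real" where
  "cost_max c i = Max (range (\<lambda>j. c $ j $ i))"

definition cost_spread :: "real ^ 'n ^ 'm \<Rightarrow> real" where
  "cost_spread c = Max (range (\<lambda>i. cost_max c i - cost_min c i))"

primrec decision_trees ::
  "real ^ 'n ^ 'm \<Rightarrow> (real ^ 'n) set \<Rightarrow> nat \<Rightarrow> ('n, real ^ 'n) dtree set" where
  "decision_trees c X 0 = Leaf ` X"
| "decision_trees c X (Suc D) =
     {Node i \<theta> l r | i \<theta> l r. \<theta> \<in> {cost_min c i..cost_max c i}
        \<and> l \<in> decision_trees c X D \<and> r \<in> decision_trees c X D}"

definition U_glob :: "real \<Rightarrow> (real ^ 'n ^ 'm) set" where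
  "U_glob \<Gamma> = {\<xi>. (\<Sum>j\<in>UNIV. \<Sum>i\<in>UNIV. \<bar>\<xi> $ j $ i\<bar>) \<le> \<Gamma>}"

definition U_loc :: "real \<Rightarrow> (real ^ 'n ^ 'm) set" where
  "U_loc \<Gamma> = {\<xi>. \<forall>j. (\<Sum>i\<in>UNIV. \<bar>\<xi> $ j $ i\<bar>) \<le> \<Gamma>}"

definition realized_cost ::
  "real ^ 'n ^ 'm \<Rightarrow> (real ^ 'n \<Rightarrow> real ^ 'n) \<Rightarrow> real ^ 'n ^ 'm \<Rightarrow> real" where
  "realized_cost c T \<xi> = (\<Sum>j\<in>UNIV. (c $ j) \<bullet> T (c $ j + \<xi> $ j))"

text \<open>
  The uncertainty set is infinite, but a tree takes only finitely many values, so the maximum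
  below is over a finite set (lemma \<open>finite_realized_costs\<close>), which is nonempty when $U$ is.
\<close>

definition worst_case_cost ::
  "real ^ 'n ^ 'm \<Rightarrow> (real ^ 'n ^ 'm) set \<Rightarrow> (real ^ 'n \<Rightarrow> real ^ 'n) \<Rightarrow> real" where
  "worst_case_cost c U T = Max (realized_cost c T ` U)"

lemma tree_map_in_solutions: "tree_map t v \<in> solutions t"
  by (induction t) auto

lemma finite_solutions: "finite (solutions t)"
  by (induction t) auto

lemma finite_realized_costs:
  fixes c :: "real ^ 'n ^ 'm" and t :: "('n, real ^ 'n) dtree"
  shows "finite (realized_cost c (tree_map t) ` U)"
proof (rule finite_subset)
  let ?F = "PiE (UNIV :: 'm set) (\<lambda>_. solutions t)"
  show "realized_cost c (tree_map t) ` U \<subseteq> (\<lambda>f. \<Sum>j\<in>UNIV. (c $ j) \<bullet> f j) ` ?F"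
  proof (rule image_subsetI)
    fix \<xi>
    have "(\<lambda>j. tree_map t (c $ j + \<xi> $ j)) \<in> ?F"
      by (simp add: PiE_iff tree_map_in_solutions)
    then show "realized_cost c (tree_map t) \<xi> \<in> (\<lambda>f. \<Sum>j\<in>UNIV. (c $ j) \<bullet> f j) ` ?F"
      unfolding realized_cost_def by (rule rev_image_eqI) simp
  qed
  show "finite ((\<lambda>f. \<Sum>j\<in>UNIV. (c $ j) \<bullet> f j) ` ?F)"
    by (intro finite_imageI finite_PiE) (simp_all add: finite_solutions)
qed

lemma U_glob_nonempty: "0 \<le> \<Gamma> \<Longrightarrow> U_glob \<Gamma> \<noteq> {}"
  by (auto simp: U_glob_def intro!: exI[of _ 0])

lemma U_loc_nonempty: "0 \<le> \<Gamma> \<Longrightarrow> U_loc \<Gamma> \<noteq> {}"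
  by (auto simp: U_loc_def intro!: exI[of _ 0])

end

theory Submission imports Defs begin

text \<open>
  All thresholds are at least \<open>cost_min c i\<close>. So lowering the entries of each item queried on the
  leftmost path of a tree to \<open>cost_min c i\<close> sends every scenario to the leftmost leaf. The path
  queries at most \<open>D\<close> items, hence this costs at most \<open>D * cost_spread c\<close> per scenario and stays
  within the budget. The adversary can thus force any tree to use one solution of \<open>X\<close> in all
  scenarios, which is no better than using \<open>xopt\<close> throughout.
\<close>

lemma cost_min_le: "cost_min c i \<le> c $ j $ i"
  unfolding cost_min_def by (rule Min_le) auto

lemma cost_max_ge: "c $ j $ i \<le> cost_max c i"
  unfolding cost_max_def by (rule Max_ge) auto

lemma cost_min_le_cost_max: "cost_min c i \<le> cost_max c i"
  using cost_min_le cost_max_ge by (rule order_trans)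

lemma cost_spread_ge: "cost_max c i - cost_min c i \<le> cost_spread c"
  unfolding cost_spread_def by (rule Max_ge) auto

lemma diff_cost_min_le_cost_spread: "c $ j $ i - cost_min c i \<le> cost_spread c"
  using cost_max_ge[of c j i] cost_spread_ge[of c i] by linarith

lemma cost_spread_nonneg: "0 \<le> cost_spread c"
  \<comment> \<open>Any item serves here; \<open>undefined\<close> just picks one.\<close>
  using cost_min_le_cost_max[of c undefined] cost_spread_ge[of c undefined] by linarith

lemma decision_trees_constant:
  assumes "x \<in> X"
  shows "\<exists>t \<in> decision_trees c X D. solutions t = {x}"
proof (induction D)
  case 0
  then show ?case using assms by auto
next
  case (Suc D)
  then obtain t where t: "t \<in> decision_trees c X D" "solutions t = {x}"
    by blast
  have "Node i (cost_min c i) t t \<in> decision_trees c X (Suc D)" for i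
    using t(1) cost_min_le_cost_max[of c i] by simp
  moreover have "solutions (Node i (cost_min c i) t t) = {x}" for i
    using t(2) by simp
  ultimately show ?case by (rule rev_bexI)
qed

lemma tree_map_constant:
  assumes "solutions t = {x}"
  shows "tree_map t = (\<lambda>_. x)"
proof
  fix v
  show "tree_map t v = x"
    using tree_map_in_solutions[of t v] assms by simp
qed

text \<open>\<open>I\<close> collects the items queried on the leftmost path and \<open>x\<close> is
  the solution at its end. An item may be queried repeatedly, so \<open>card I\<close> is only
  bounded by the depth.\<close>

lemma leftmost_leaf:
  assumes "t \<in> decision_trees c X D"
  obtains I x where "card I \<le> D" "x \<in> X"
    "\<And>v. (\<And>i. i \<in> I \<Longrightarrow> v $ i \<le> cost_min c i) \<Longrightarrow> tree_map t v = x"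
  using assms
proof (induction D arbitrary: t thesis)
  case 0
  from "0.prems"(2) obtain x where "x \<in> X" "t = Leaf x" by auto
  then show ?case by (intro "0.prems"(1)[of "{}" x]) auto
next
  case (Suc D)
  from Suc.prems(2) obtain i \<theta> l r where t: "t = Node i \<theta> l r" "cost_min c i \<le> \<theta>"
    "l \<in> decision_trees c X D" by auto
  from Suc.IH[OF _ t(3)] obtain I x where I: "card I \<le> D" "x \<in> X"
    "\<And>v. (\<And>i. i \<in> I \<Longrightarrow> v $ i \<le> cost_min c i) \<Longrightarrow> tree_map l v = x" by blast
  show ?case
  proof (rule Suc.prems(1))
    show "card (insert i I) \<le> Suc D"
      using I(1) card_insert_le_m1[of "Suc D" I i] by simp
    show "x \<in> X" by fact
    show "tree_map t v = x" if "\<And>k. k \<in> insert i I \<Longrightarrow> v $ k \<le> cost_min c k" for v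
    proof -
      have "v $ i \<le> \<theta>" using that[of i] t(2) by simp
      moreover have "tree_map l v = x" using that by (intro I(3)) simp
      ultimately show ?thesis using t(1) by simp
    qed
  qed
qed

text \<open>Summing one local budget per scenario lets the global case be reduced to the local
  one.\<close>

lemma U_loc_subset_U_glob:
  "U_loc \<Gamma> \<subseteq> (U_glob (real CARD('m) * \<Gamma>) :: (real ^ 'n ^ 'm) set)"
proof
  fix \<xi> :: "real ^ 'n ^ 'm"
  assume "\<xi> \<in> U_loc \<Gamma>"
  then show "\<xi> \<in> U_glob (real CARD('m) * \<Gamma>)"
    unfolding U_loc_def U_glob_def mem_Collect_eq by (intro sum_bounded_above) blast
qed

lemma U_glob_mono: "\<Gamma> \<le> \<Gamma>' \<Longrightarrow> U_glob \<Gamma> \<subseteq> U_glob \<Gamma>'"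
  unfolding U_glob_def by auto

lemma U_loc_mono: "\<Gamma> \<le> \<Gamma>' \<Longrightarrow> U_loc \<Gamma> \<subseteq> U_loc \<Gamma>'"
  unfolding U_loc_def by (blast intro: order_trans)

lemma U_loc_forces_solution:
  fixes c :: "real ^ 'n ^ 'm"
  assumes "t \<in> decision_trees c X D"
  shows "\<exists>\<xi> \<in> U_loc (real D * cost_spread c). \<exists>x \<in> X. \<forall>j. tree_map t (c $ j + \<xi> $ j) = x"
proof -
  from leftmost_leaf[OF assms] obtain I x where I: "card I \<le> D" "x \<in> X"
    "\<And>v. (\<And>i. i \<in> I \<Longrightarrow> v $ i \<le> cost_min c i) \<Longrightarrow> tree_map t v = x" by blast
  \<comment> \<open>This choice makes entry \<open>i\<close> of every perturbed scenario equal to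
    \<open>cost_min c i\<close> for all \<open>i\<close> in \<open>I\<close>, so all scenarios take
    the same path.\<close>
  define \<xi> :: "real ^ 'n ^ 'm" where
    "\<xi> = (\<chi> j i. if i \<in> I then cost_min c i - c $ j $ i else 0)"
  have "(\<Sum>i\<in>UNIV. \<bar>\<xi> $ j $ i\<bar>) \<le> real D * cost_spread c" for j
  proof -
    have "(\<Sum>i\<in>UNIV. \<bar>\<xi> $ j $ i\<bar>) = (\<Sum>i\<in>I. \<bar>\<xi> $ j $ i\<bar>)"
      by (rule sum.mono_neutral_right) (auto simp: \<xi>_def)
    \<comment> \<open>On \<open>I\<close> each shift is nonpositive, and its size is the distance of
      an entry from the minimum of its item.\<close>
    also have "\<dots> \<le> real (card I) * cost_spread c"
      using cost_min_le[of c _ j] diff_cost_min_le_cost_spread[of c j]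
      by (intro sum_bounded_above) (simp add: \<xi>_def abs_of_nonpos)
    also have "\<dots> \<le> real D * cost_spread c"
      using I(1) cost_spread_nonneg by (intro mult_right_mono) auto
    finally show ?thesis .
  qed
  then have "\<xi> \<in> U_loc (real D * cost_spread c)" by (simp add: U_loc_def)
  moreover have "tree_map t (c $ j + \<xi> $ j) = x" for j
    by (rule I(3)) (simp add: \<xi>_def)
  ultimately show ?thesis using I(2) by blast
qed

text \<open>Perturbations only affect which leaf is chosen, never the costs that are paid. For
  nonempty \<open>U\<close> the maximum is thus over a singleton.\<close>

lemma worst_case_cost_constant:
  assumes "U \<noteq> {}"
  shows "worst_case_cost c U (\<lambda>_. x) = (\<Sum>j\<in>UNIV. (c $ j) \<bullet> x)"
  using assms by (simp add: worst_case_cost_def realized_cost_def[abs_def] image_constant_conv)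

lemma worst_case_cost_ge:
  assumes "\<xi> \<in> U"
  shows "realized_cost c (tree_map t) \<xi> \<le> worst_case_cost c U (tree_map t)"
  unfolding worst_case_cost_def using assms finite_realized_costs by (intro Max_ge) auto

text \<open>The inner items and thresholds of a tree with \<open>xopt\<close> in every leaf are
  arbitrary. Hence the claim is that such a tree exists and that every such tree is optimal.\<close>

theorem theorem4p1:
  fixes X :: "(real ^ 'n) set"
    and c :: "real ^ 'n ^ 'm"
    and D :: nat
    and U :: "(real ^ 'n ^ 'm) set"
    and \<Gamma>glob \<Gamma>loc :: real
    and xopt :: "real ^ 'n"
  assumes "X \<noteq> {}"
    and "\<And>w. \<exists>x. is_arg_min (\<lambda>x. w \<bullet> x) (\<lambda>x. x \<in> X) x"
    and "(U = U_glob \<Gamma>glob \<and> \<Gamma>glob > real D * real CARD('m) * cost_spread c)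
       \<or> (U = U_loc \<Gamma>loc \<and> \<Gamma>loc > real D * cost_spread c)"
    and "is_arg_min (\<lambda>x. \<Sum>j\<in>UNIV. (c $ j) \<bullet> x) (\<lambda>x. x \<in> X) xopt"
  shows "(\<exists>t \<in> decision_trees c X D. solutions t = {xopt})
       \<and> (\<forall>t \<in> decision_trees c X D. solutions t = {xopt} \<longrightarrow>
            tree_map t = (\<lambda>_. xopt)
            \<and> is_arg_min (\<lambda>T. worst_case_cost c U (tree_map T))
                (\<lambda>T. T \<in> decision_trees c X D) t)"
proof (intro conjI ballI impI)
  let ?cost = "\<lambda>x. \<Sum>j\<in>UNIV. (c $ j) \<bullet> x"
  have xopt: "xopt \<in> X" "\<And>x. x \<in> X \<Longrightarrow> ?cost xopt \<le> ?cost x"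
    using assms(4) by (auto simp: is_arg_min_linorder)
  show "\<exists>t \<in> decision_trees c X D. solutions t = {xopt}"
    using xopt(1) by (rule decision_trees_constant)
  \<comment> \<open>Both cases of the hypothesis enter only through this inclusion, which makes the
    forcing perturbations available in \<open>U\<close>.\<close>
  have U: "U_loc (real D * cost_spread c) \<subseteq> U"
    using assms(3)
  proof
    assume glob: "U = U_glob \<Gamma>glob \<and> \<Gamma>glob > real D * real CARD('m) * cost_spread c"
    then have "real CARD('m) * (real D * cost_spread c) \<le> \<Gamma>glob" by (simp add: mult_ac)
    from order_trans[OF U_loc_subset_U_glob U_glob_mono[OF this]] glob show ?thesis by simp
  next
    assume "U = U_loc \<Gamma>loc \<and> \<Gamma>loc > real D * cost_spread c"
    then show ?thesis using U_loc_mono[of "real D * cost_spread c" \<Gamma>loc] by simp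
  qed
  then have "U \<noteq> {}"
    using U_loc_nonempty[of "real D * cost_spread c"] cost_spread_nonneg[of c] by auto
  fix t assume t: "t \<in> decision_trees c X D" "solutions t = {xopt}"
  show const: "tree_map t = (\<lambda>_. xopt)"
    using t(2) by (rule tree_map_constant)
  \<comment> \<open>The worst case of \<open>s\<close> is at least its cost under the forcing
    perturbation, which is the nominal cost of a single feasible \<open>x\<close>.\<close>
  have "worst_case_cost c U (tree_map t) \<le> worst_case_cost c U (tree_map s)"
    if s: "s \<in> decision_trees c X D" for s
  proof -
    obtain \<xi> x where "\<xi> \<in> U_loc (real D * cost_spread c)" and x: "x \<in> X"
      and \<xi>: "\<And>j. tree_map s (c $ j + \<xi> $ j) = x"
      using U_loc_forces_solution[OF s] by blast
    with U have "\<xi> \<in> U" by blast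
    have "worst_case_cost c U (tree_map t) = ?cost xopt"
      using const worst_case_cost_constant[OF \<open>U \<noteq> {}\<close>] by simp
    also have "\<dots> \<le> ?cost x" using x by (rule xopt(2))
    also have "\<dots> = realized_cost c (tree_map s) \<xi>" by (simp add: realized_cost_def \<xi>)
    also have "\<dots> \<le> worst_case_cost c U (tree_map s)" using \<open>\<xi> \<in> U\<close> by (rule worst_case_cost_ge)
    finally show ?thesis .
  qed
  with t(1) show "is_arg_min (\<lambda>T. worst_case_cost c U (tree_map T))
      (\<lambda>T. T \<in> decision_trees c X D) t"
    by (simp add: is_arg_min_linorder)
qed

end
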